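(* Let $(\mathcal{A},\mathcal{B})$ be a $\frac{1}{2}$-cross intersecting pair of families of subsets of $[n]$ with $|\mathcal{A}||\mathcal{B}|=2^n$. Then, up to isomorphism, $(\mathcal{A},\mathcal{B})$ is one of the following $\lfloor\frac{n}{2}\rfloor+1$ pairs of families $(\mathcal{A}_k,\mathcal{B}_k)$, $0\le k\le\lfloor\frac{n}{2}\rfloor$: $$\mathcal{A}_0=2^{[n]},\qquad \mathcal{B}_0=\{\emptyset\},$$ and, for $1\le k\le\lfloor\frac{n}{2}\rfloor$, $$\mathcal{A}_k=\{A\in 2^{[n]} : |A\cap\{2i-1,2i\}|=1 \text{ for all } i,\ 1\le i\le k\},$$ $$\mathcal{B}_k=\{B\in 2^{[n]} : |B\cap\{2i-1,2i\}|\in\{0,2\} \text{ for all } i,\ 1\le i\le k,\ \text{and } j\notin B \text{ for all } j>2k\}.$$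
   Context: $[n]=\{1,\ldots,n\}$ and $2^{[n]}$ is its power set. A pair $(\mathcal{A},\mathcal{B})$ of families of subsets of $[n]$ is a $\frac{1}{2}$-cross intersecting pair if $|A\cap B|=\frac{1}{2}|B|$ for every $A\in\mathcal{A}$ and every $B\in\mathcal{B}$. "Up to isomorphism" means: there is a bijection $f:[n]\to[n]$ such that, writing $A_f=\{f(i): i\in A\}$ and $B_f=\{f(i): i\in B\}$, the pair $(\{A_f: A\in\mathcal{A}\},\{B_f: B\in\mathcal{B}\})$ equals $(\mathcal{A}_k,\mathcal{B}_k)$ for some $k$ with $0\le k\le\lfloor\frac{n}{2}\rfloor$. *)

theory Defs
  imports Complex_Main
begin

definition half_cross_intersecting :: "nat \<Rightarrow> nat set set \<Rightarrow> nat set set \<Rightarrow> bool" where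
  "half_cross_intersecting n \<A> \<B> \<longleftrightarrow>
     \<A> \<subseteq> Pow {1..n} \<and> \<B> \<subseteq> Pow {1..n} \<and>
     (\<forall>A\<in>\<A>. \<forall>B\<in>\<B>. real (card (A \<inter> B)) = 1/2 * real (card B))"

definition \<A>_fam :: "nat \<Rightarrow> nat \<Rightarrow> nat set set" where
  "\<A>_fam n k =
     (if k = 0 then Pow {1..n}
      else {A \<in> Pow {1..n}. \<forall>i\<in>{1..k}. card (A \<inter> {2*i - 1, 2*i}) = 1})"

definition \<B>_fam :: "nat \<Rightarrow> nat \<Rightarrow> nat set set" where
  "\<B>_fam n k =
     (if k = 0 then {{}}
      else {B \<in> Pow {1..n}. (\<forall>i\<in>{1..k}. card (B \<inter> {2*i - 1, 2*i}) \<in> {0, 2}) \<and>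
                             (\<forall>j>2*k. j \<notin> B)})"

text \<open>The image of a family under a relabelling of the ground set: \<open>{A\<^sub>f : A \<in> \<F>}\<close>.\<close>

definition relabel :: "(nat \<Rightarrow> nat) \<Rightarrow> nat set set \<Rightarrow> nat set set" where
  "relabel f \<F> = (\<lambda>A. f ` A) ` \<F>"

end

theory Submission
  imports Defs
begin

text \<open>
  Encode the members of \<open>\<B>\<close> as 0/1 vectors and choose a set \<open>I\<close> of coordinates that is a basis of
  the coordinate functionals restricted to \<open>\<B>\<close>. Every coordinate outside \<open>I\<close> is then a fixed linear
  combination of those in \<open>I\<close>, so \<open>B\<close> is determined by \<open>B \<inter> I\<close>. Dually \<open>A\<close> is determined by \<open>A - I\<close>:
  if \<open>A\<close> and \<open>A'\<close> agree outside \<open>I\<close>, the difference of their indicator vectors is supported on \<open>I\<close>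
  and is orthogonal to every \<open>B\<close>, because \<open>\<bar>A \<inter> B\<bar> = \<bar>B\<bar> / 2 = \<bar>A' \<inter> B\<bar>\<close>; independence makes it
  vanish. Hence \<open>\<bar>\<A>\<bar> \<le> 2 ^ (n - \<bar>I\<bar>)\<close> and \<open>\<bar>\<B>\<bar> \<le> 2 ^ \<bar>I\<bar>\<close>.

  When the product is \<open>2 ^ n\<close>, both bounds are attained and every trace occurs. Let \<open>S i\<close> be the
  member of \<open>\<B>\<close> with trace \<open>{i}\<close>. The coefficient of \<open>i\<close> in the combination for \<open>j\<close> is then the
  \<open>j\<close>-th coordinate of \<open>S i\<close>, and a member with trace \<open>{i, i'}\<close> shows that two of these coefficients
  cannot both be 1: its \<open>j\<close>-th coordinate would be 2. So the \<open>S i\<close> are disjoint. Some \<open>A\<close> contains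
  everything outside \<open>I\<close>, so it meets \<open>S i\<close> in at least \<open>\<bar>S i\<bar> - 1\<close> points and also in exactly
  \<open>\<bar>S i\<bar> / 2\<close>, which forces \<open>S i\<close> to be a pair \<open>{i, p i}\<close>. The members of \<open>\<B>\<close> are therefore unions of
  these pairs and the members of \<open>\<A>\<close> are transversals of them; as all traces occur, every such
  union and every such transversal is present (lemma \<open>extremal_half_cross_structure\<close>). It remains
  to rename the pairs to \<open>{1, 2}, {3, 4}, \<dots>\<close>.
\<close>

section \<open>Independent coordinates\<close>

text \<open>Linear independence over the reals of the functionals
  \<open>B \<mapsto> of_bool (i \<in> B)\<close> for \<open>i \<in> I\<close> on the 0/1 vectors in \<open>\<B>\<close>: the inner sum is the value at \<open>B\<close>
  of the combination with coefficients \<open>c\<close>.\<close>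

definition coord_independent :: "'a set set \<Rightarrow> 'a set \<Rightarrow> bool" where
  "coord_independent \<B> I \<longleftrightarrow>
     (\<forall>c :: 'a \<Rightarrow> real. (\<forall>B\<in>\<B>. (\<Sum>i\<in>B \<inter> I. c i) = 0) \<longrightarrow> (\<forall>i\<in>I. c i = 0))"

lemma coord_basis_exists:
  assumes "finite X"
  obtains I where "I \<subseteq> X" "coord_independent \<B> I"
    "\<And>j. j \<in> X - I \<Longrightarrow> \<not> coord_independent \<B> (insert j I)"
proof -
  let ?F = "{I. I \<subseteq> X \<and> coord_independent \<B> I}"
  have "finite ?F" using assms by simp
  moreover have "{} \<in> ?F" by (simp add: coord_independent_def)
  ultimately have "\<exists>I\<in>?F. \<forall>J\<in>?F. I \<subseteq> J \<longrightarrow> I = J"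
    by (intro finite_has_maximal) auto
  then obtain I where I: "I \<in> ?F" "\<forall>J\<in>?F. I \<subseteq> J \<longrightarrow> I = J" ..
  show thesis
  proof (rule that)
    show "I \<subseteq> X" "coord_independent \<B> I" using I(1) by auto
    show "\<not> coord_independent \<B> (insert j I)" if "j \<in> X - I" for j
      using bspec[OF I(2), of "insert j I"] I(1) that by auto
  qed
qed

text \<open>A nontrivial relation on \<open>insert j I\<close> must involve \<open>j\<close>, since otherwise it would be a relation on
  \<open>I\<close>; so it can be solved for the coordinate \<open>j\<close>.\<close>

lemma dependent_coord_is_combination:
  assumes fin: "finite I" and ind: "coord_independent \<B> I" and j: "j \<notin> I"
    and dep: "\<not> coord_independent \<B> (insert j I)"
  shows "\<exists>m :: 'a \<Rightarrow> real. \<forall>B\<in>\<B>. of_bool (j \<in> B) = (\<Sum>i\<in>B \<inter> I. m i)"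
proof -
  obtain c :: "'a \<Rightarrow> real" where c: "\<And>B. B \<in> \<B> \<Longrightarrow> (\<Sum>i\<in>B \<inter> insert j I. c i) = 0"
    and nz: "\<exists>i\<in>insert j I. c i \<noteq> 0"
    using dep unfolding coord_independent_def by blast
  have split: "(\<Sum>i\<in>B \<inter> insert j I. c i) = c j * of_bool (j \<in> B) + (\<Sum>i\<in>B \<inter> I. c i)" for B
    using fin j by (simp add: Int_insert_right)
  have "c j \<noteq> 0"
  proof
    assume "c j = 0"
    then have "\<forall>B\<in>\<B>. (\<Sum>i\<in>B \<inter> I. c i) = 0" using c split by simp
    then show False using ind nz \<open>c j = 0\<close> unfolding coord_independent_def by auto
  qed
  show ?thesis
  proof (intro exI ballI)
    fix B assume "B \<in> \<B>"
    then have "c j * of_bool (j \<in> B) = - (\<Sum>i\<in>B \<inter> I. c i)" using c split by (simp add: eq_neg_iff_add_eq_0)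
    then have "of_bool (j \<in> B) = - (\<Sum>i\<in>B \<inter> I. c i) / c j" using \<open>c j \<noteq> 0\<close>
      by (metis nonzero_mult_div_cancel_left)
    then show "of_bool (j \<in> B) = (\<Sum>i\<in>B \<inter> I. - c i / c j)"
      by (simp add: sum_divide_distrib sum_negf)
  qed
qed

text \<open>The difference of the indicator vectors of two members of \<open>\<A>\<close> is orthogonal to all of \<open>\<B>\<close>. If
  it is supported on \<open>I\<close>, it is itself a linear relation among the coordinates in \<open>I\<close>.\<close>

lemma inj_on_trace_off_independent:
  assumes fin: "finite I" "\<And>B. B \<in> \<B> \<Longrightarrow> finite B" and ind: "coord_independent \<B> I"
    and half: "\<And>A B. A \<in> \<A> \<Longrightarrow> B \<in> \<B> \<Longrightarrow> 2 * card (A \<inter> B) = card B"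
  shows "inj_on (\<lambda>A. A - I) \<A>"
proof (rule inj_onI)
  fix A A' assume A: "A \<in> \<A>" "A' \<in> \<A>" and off: "A - I = A' - I"
  let ?c = "\<lambda>i. of_bool (i \<in> A) - of_bool (i \<in> A') :: real"
  have "(\<Sum>i\<in>B \<inter> I. ?c i) = 0" if B: "B \<in> \<B>" for B
  proof -
    have "(\<Sum>i\<in>B \<inter> I. ?c i) = (\<Sum>i\<in>B. ?c i)"
      using fin(2)[OF B] off by (intro sum.mono_neutral_left) auto
    also have "\<dots> = real (card (A \<inter> B)) - real (card (A' \<inter> B))"
      using fin(2)[OF B] by (simp add: sum_subtractf sum_of_bool_eq Int_def conj_commute)
    also have "\<dots> = 0" using half[OF A(1) B] half[OF A(2) B] by simp
    finally show ?thesis .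
  qed
  then have "\<forall>i\<in>I. ?c i = 0" using ind unfolding coord_independent_def by blast
  then have "i \<in> A \<longleftrightarrow> i \<in> A'" if "i \<in> I" for i
    using that by (cases "i \<in> A"; cases "i \<in> A'") auto
  with off show "A = A'" by blast
qed

section \<open>The structure of extremal pairs\<close>

text \<open>Equality in the two trace bounds supplies members with any prescribed trace: singleton and
  doubleton traces on \<open>I\<close> give disjoint blocks, the full trace off \<open>I\<close> makes the blocks pairs. Here
  \<open>I\<close> picks one point of each pair and \<open>p\<close> sends it to its partner.\<close>

lemma extremal_half_cross_structure:
  assumes fin: "finite X" and sub: "\<A> \<subseteq> Pow X" "\<B> \<subseteq> Pow X"
    and half: "\<And>A B. A \<in> \<A> \<Longrightarrow> B \<in> \<B> \<Longrightarrow> 2 * card (A \<inter> B) = card B"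
    and card: "card \<A> * card \<B> = 2 ^ card X"
  obtains I p where "I \<subseteq> X" "p ` I \<subseteq> X - I" "inj_on p I"
    "\<A> = {A \<in> Pow X. \<forall>i\<in>I. i \<in> A \<longleftrightarrow> p i \<notin> A}"
    "\<B> = {B \<in> Pow (I \<union> p ` I). \<forall>i\<in>I. i \<in> B \<longleftrightarrow> p i \<in> B}"
proof -
  obtain I where I: "I \<subseteq> X" and ind: "coord_independent \<B> I"
    and dep: "\<And>j. j \<in> X - I \<Longrightarrow> \<not> coord_independent \<B> (insert j I)"
    using coord_basis_exists[OF fin] by blast
  have finI: "finite I" using I fin by (rule finite_subset)
  have finB: "finite B" if "B \<in> \<B>" for B using that sub(2) fin by (auto intro: finite_subset)
  have "\<exists>m. \<forall>B\<in>\<B>. of_bool (j \<in> B) = (\<Sum>i\<in>B \<inter> I. m i :: real)" if j: "j \<in> X - I" for j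
    using dependent_coord_is_combination[OF finI ind _ dep[OF j]] j by simp
  \<comment> \<open>Row \<open>j\<close> of the matrix \<open>m\<close> expresses the coordinate \<open>j\<close> in terms of the basis \<open>I\<close>.\<close>
  then obtain m :: "'a \<Rightarrow> 'a \<Rightarrow> real" where
    m: "\<And>j B. j \<in> X - I \<Longrightarrow> B \<in> \<B> \<Longrightarrow> of_bool (j \<in> B) = (\<Sum>i\<in>B \<inter> I. m j i)"
    by metis
  have injA: "inj_on (\<lambda>A. A - I) \<A>"
    using inj_on_trace_off_independent[OF finI finB ind half] by blast
  have injB: "inj_on (\<lambda>B. B \<inter> I) \<B>"
  proof (rule inj_onI)
    fix B B' assume B: "B \<in> \<B>" "B' \<in> \<B>" and eq: "B \<inter> I = B' \<inter> I"
    have "j \<in> B \<longleftrightarrow> j \<in> B'" if "j \<in> X - I" for j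
      using m[OF that B(1)] m[OF that B(2)] eq by (simp split: if_splits add: of_bool_def)
    then show "B = B'" using eq B sub(2) by blast
  qed
  have imA: "(\<lambda>A. A - I) ` \<A> \<subseteq> Pow (X - I)" and imB: "(\<lambda>B. B \<inter> I) ` \<B> \<subseteq> Pow I"
    using sub by auto
  have fins: "finite (Pow (X - I))" "finite (Pow I)" using fin finI by auto
  have leA: "card \<A> \<le> 2 ^ card (X - I)"
    using card_mono[OF fins(1) imA] card_image[OF injA] fin by (simp add: card_Pow)
  have leB: "card \<B> \<le> 2 ^ card I"
    using card_mono[OF fins(2) imB] card_image[OF injB] finI by (simp add: card_Pow)
  have prod: "card \<A> * card \<B> = 2 ^ card (X - I) * 2 ^ card I"
    using card I fin finI by (simp add: card_Diff_subset card_mono flip: power_add)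
  have "card \<A> = 2 ^ card (X - I)"
  proof (rule ccontr)
    assume "card \<A> \<noteq> 2 ^ card (X - I)"
    then have "card \<A> < 2 ^ card (X - I)" using leA by simp
    moreover have "0 < card \<B>" using card by (cases "card \<B>") auto
    ultimately have "card \<A> * card \<B> < 2 ^ card (X - I) * 2 ^ card I"
      using leB by (intro mult_less_le_imp_less) auto
    with prod show False by simp
  qed
  moreover from this have "card \<B> = 2 ^ card I" using prod by simp
  ultimately have traceA: "(\<lambda>A. A - I) ` \<A> = Pow (X - I)" and traceB: "(\<lambda>B. B \<inter> I) ` \<B> = Pow I"
    using card_subset_eq[OF fins(1) imA] card_subset_eq[OF fins(2) imB]
      card_image[OF injA] card_image[OF injB] fin finI by (simp_all add: card_Pow)
  have exB: "\<exists>B\<in>\<B>. B \<inter> I = T" if "T \<subseteq> I" for T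
    using that traceB by (metis (no_types, lifting) Pow_iff imageE)
  have exA: "\<exists>A\<in>\<A>. A - I = T" if "T \<subseteq> X - I" for T
    using that traceA by (metis (no_types, lifting) Pow_iff imageE)
  have "\<forall>i\<in>I. \<exists>B\<in>\<B>. B \<inter> I = {i}" by (intro ballI exB) simp
  then obtain S where S: "\<And>i. i \<in> I \<Longrightarrow> S i \<in> \<B>" "\<And>i. i \<in> I \<Longrightarrow> S i \<inter> I = {i}"
    by metis
  have mS: "m j i = of_bool (j \<in> S i)" if "j \<in> X - I" "i \<in> I" for i j
    using m[OF that(1) S(1)[OF that(2)]] S(2)[OF that(2)] by simp
  have disj: "i = i'" if ii: "i \<in> I" "i' \<in> I" and j: "j \<in> X - I" "j \<in> S i" "j \<in> S i'" for i i' j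
  proof (rule ccontr)
    assume "i \<noteq> i'"
    obtain B where B: "B \<in> \<B>" "B \<inter> I = {i, i'}" using exB[of "{i, i'}"] ii by auto
    have "of_bool (j \<in> B) = (2 :: real)"
      using m[OF j(1) B(1)] B(2) \<open>i \<noteq> i'\<close> mS[OF j(1)] ii j by simp
    then show False by (cases "j \<in> B") auto
  qed
  \<comment> \<open>A member of \<open>\<A>\<close> that misses at most the point \<open>i\<close> of each block \<open>S i\<close>\<close>
  obtain A0 where A0: "A0 \<in> \<A>" "A0 - I = X - I" using exA[of "X - I"] by auto
  have "\<exists>q. q \<in> X - I \<and> S i = {i, q}" if i: "i \<in> I" for i
  proof -
    have SX: "S i \<subseteq> X" using S(1)[OF i] sub(2) by auto
    have iS: "i \<in> S i" using S(2)[OF i] by auto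
    have fS: "finite (S i)" using finB S(1)[OF i] by blast
    have "S i - {i} \<subseteq> A0 \<inter> S i" using S(2)[OF i] SX A0(2) by blast
    then have "card (S i - {i}) \<le> card (A0 \<inter> S i)" using fS by (intro card_mono) auto
    then have "card (S i) - 1 \<le> card (A0 \<inter> S i)" using iS fS by simp
    moreover have "2 * card (A0 \<inter> S i) = card (S i)" using half[OF A0(1) S(1)[OF i]] .
    moreover have "card (S i) > 0" using iS fS card_gt_0_iff by blast
    ultimately have "card (S i) = 2" by presburger
    then have "card (S i - {i}) = 1" using iS fS by simp
    then obtain q where "S i - {i} = {q}" by (rule card_1_singletonE)
    then have "S i = {i, q}" "q \<noteq> i" using iS by auto
    then show ?thesis using S(2)[OF i] SX by auto
  qed
  then obtain p where p: "\<And>i. i \<in> I \<Longrightarrow> p i \<in> X - I" "\<And>i. i \<in> I \<Longrightarrow> S i = {i, p i}"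
    by metis
  have injp: "inj_on p I"
    using disj p by (intro inj_onI) (metis insertI1 insertI2)
  have memB: "j \<in> B \<longleftrightarrow> j \<in> p ` (B \<inter> I)" if j: "j \<in> X - I" and B: "B \<in> \<B>" for j B
  proof -
    have "of_bool (j \<in> B) = (\<Sum>i\<in>B \<inter> I. of_bool (j = p i) :: real)"
      using m[OF j B] mS[OF j] p(2) j by (auto intro!: sum.cong simp: of_bool_def)
    also have "(\<dots> = 0) \<longleftrightarrow> (\<forall>i\<in>B \<inter> I. j \<noteq> p i)"
      using finI by (subst sum_nonneg_eq_0_iff) auto
    finally show ?thesis by auto
  qed
  have B1: "B \<in> Pow (I \<union> p ` I) \<and> (\<forall>i\<in>I. i \<in> B \<longleftrightarrow> p i \<in> B)" if B: "B \<in> \<B>" for B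
  proof -
    have "B \<subseteq> X" using B sub(2) by auto
    moreover have "i \<in> B \<longleftrightarrow> p i \<in> B" if "i \<in> I" for i
      using memB[OF p(1)[OF that] B] that inj_on_image_mem_iff[OF injp that, of "B \<inter> I"] by auto
    ultimately show ?thesis using memB[OF _ B] by blast
  qed
  have A1: "i \<in> A \<longleftrightarrow> p i \<notin> A" if A: "A \<in> \<A>" and i: "i \<in> I" for A i
  proof -
    have "i \<noteq> p i" using p(1)[OF i] i by auto
    then have "card (A \<inter> {i, p i}) = 1" using half[OF A S(1)[OF i]] p(2)[OF i] by simp
    then show ?thesis using \<open>i \<noteq> p i\<close> by (cases "i \<in> A"; cases "p i \<in> A") auto
  qed
  show thesis
  proof (rule that[OF I _ injp])
    show "p ` I \<subseteq> X - I" using p(1) by auto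
    show "\<A> = {A \<in> Pow X. \<forall>i\<in>I. i \<in> A \<longleftrightarrow> p i \<notin> A}"
    proof (intro equalityI subsetI)
      fix A assume "A \<in> \<A>"
      then show "A \<in> {A \<in> Pow X. \<forall>i\<in>I. i \<in> A \<longleftrightarrow> p i \<notin> A}" using A1 sub(1) by blast
    next
      fix A assume A: "A \<in> {A \<in> Pow X. \<forall>i\<in>I. i \<in> A \<longleftrightarrow> p i \<notin> A}"
      then obtain A' where A': "A' \<in> \<A>" "A' - I = A - I" using exA[of "A - I"] by blast
      have "i \<in> A' \<longleftrightarrow> i \<in> A" if "i \<in> I" for i
        using A1[OF A'(1) that] A that p(1)[OF that] A'(2) by blast
      then have "A' = A" using A'(2) by blast
      then show "A \<in> \<A>" using A'(1) by simp
    qed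
    show "\<B> = {B \<in> Pow (I \<union> p ` I). \<forall>i\<in>I. i \<in> B \<longleftrightarrow> p i \<in> B}"
    proof (intro equalityI subsetI)
      fix B assume "B \<in> \<B>"
      then show "B \<in> {B \<in> Pow (I \<union> p ` I). \<forall>i\<in>I. i \<in> B \<longleftrightarrow> p i \<in> B}" using B1 by blast
    next
      fix B assume B: "B \<in> {B \<in> Pow (I \<union> p ` I). \<forall>i\<in>I. i \<in> B \<longleftrightarrow> p i \<in> B}"
      obtain B' where B': "B' \<in> \<B>" "B' \<inter> I = B \<inter> I" using exB[of "B \<inter> I"] by blast
      have "B' = B" using B B1[OF B'(1)] B'(2) by blast
      then show "B \<in> \<B>" using B'(1) by simp
    qed
  qed
qed

section \<open>Relabelling the pairs\<close>

lemma card_Int_doubleton: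
  assumes "a \<noteq> b"
  shows "card (A \<inter> {a, b}) = of_bool (a \<in> A) + of_bool (b \<in> A)"
  using assms by (cases "a \<in> A"; cases "b \<in> A") auto

text \<open>For \<open>k = 0\<close> the membership conditions below reduce to the two exceptional families, so no case
  distinction on \<open>k\<close> is left.\<close>

lemma \<A>_fam_iff:
  "A \<in> \<A>_fam n k \<longleftrightarrow> A \<subseteq> {1..n} \<and> (\<forall>i\<in>{1..k}. 2 * i - 1 \<in> A \<longleftrightarrow> 2 * i \<notin> A)"
proof -
  have "card (A \<inter> {2 * i - 1, 2 * i}) = 1 \<longleftrightarrow> (2 * i - 1 \<in> A \<longleftrightarrow> 2 * i \<notin> A)"
    if "i \<in> {1..k}" for i
    using that by (subst card_Int_doubleton) auto
  then show ?thesis unfolding \<A>_fam_def by auto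
qed

lemma \<B>_fam_iff:
  assumes "2 * k \<le> n"
  shows "B \<in> \<B>_fam n k \<longleftrightarrow> B \<subseteq> {1..2 * k} \<and> (\<forall>i\<in>{1..k}. 2 * i - 1 \<in> B \<longleftrightarrow> 2 * i \<in> B)"
proof -
  have "card (B \<inter> {2 * i - 1, 2 * i}) \<in> {0, 2} \<longleftrightarrow> (2 * i - 1 \<in> B \<longleftrightarrow> 2 * i \<in> B)"
    if "i \<in> {1..k}" for i
    using that by (subst card_Int_doubleton) auto
  moreover have "B \<subseteq> {1..n} \<and> (\<forall>j>2 * k. j \<notin> B) \<longleftrightarrow> B \<subseteq> {1..2 * k}"
    using assms by (force simp: subset_iff not_less[symmetric])
  ultimately show ?thesis unfolding \<B>_fam_def by auto
qed

lemma relabel_eqI: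
  assumes f: "bij_betw f X Y" and "\<F> \<subseteq> Pow X" "\<G> \<subseteq> Pow Y"
    and mem: "\<And>A. A \<subseteq> X \<Longrightarrow> f ` A \<in> \<G> \<longleftrightarrow> A \<in> \<F>"
  shows "relabel f \<F> = \<G>"
proof (intro equalityI subsetI)
  fix G assume "G \<in> relabel f \<F>"
  then show "G \<in> \<G>" using assms(2) mem by (auto simp: relabel_def)
next
  fix G assume "G \<in> \<G>"
  moreover from this obtain A where "A \<subseteq> X" "G = f ` A"
    using assms(3) bij_betw_imp_surj_on[OF f] by (metis PowD subset_imageE subsetD)
  ultimately show "G \<in> relabel f \<F>" using mem by (auto simp: relabel_def)
qed

text \<open>An enumeration \<open>e\<close> of \<open>I\<close> dictates \<open>f\<close> on the pairs, and the remaining points are matched with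
  \<open>{2 * card I<..n}\<close> arbitrarily. As \<open>{1..n}\<close> is finite, surjectivity of the resulting map is enough.\<close>

lemma pairs_standard_labelling:
  fixes n :: nat
  assumes I: "I \<subseteq> {1..n}" "p ` I \<subseteq> {1..n} - I" and p: "inj_on p I"
  obtains f e where "bij_betw f {1..n} {1..n}" "bij_betw e I {1..card I}"
    "\<And>i. i \<in> I \<Longrightarrow> f i = 2 * e i - 1" "\<And>i. i \<in> I \<Longrightarrow> f (p i) = 2 * e i"
    "2 * card I \<le> n"
proof -
  let ?k = "card I" and ?R = "{1..n} - (I \<union> p ` I)"
  have finI: "finite I" using I(1) finite_subset by blast
  have disj: "I \<inter> p ` I = {}" using I(2) by auto
  have cU: "card (I \<union> p ` I) = 2 * ?k"
    using finI disj by (simp add: card_Un_disjoint card_image[OF p])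
  have U: "I \<union> p ` I \<subseteq> {1..n}" using I by auto
  have le: "2 * ?k \<le> n" using card_mono[OF _ U] cU by simp
  obtain e where e: "bij_betw e I {1..?k}"
    using finI by (metis card_atLeastAtMost diff_Suc_1 finite_atLeastAtMost finite_same_card_bij)
  have "card ?R = card {2 * ?k<..n}"
    using U cU finI by (simp add: card_Diff_subset)
  then obtain h where h: "bij_betw h ?R {2 * ?k<..n}"
    by (metis finite_Diff finite_atLeastAtMost finite_greaterThanAtMost finite_same_card_bij)
  let ?q = "the_inv_into I p"
  define f where "f x = (if x \<in> I then 2 * e x - 1 else if x \<in> p ` I then 2 * e (?q x) else h x)" for x
  have f1: "f i = 2 * e i - 1" if "i \<in> I" for i using that by (simp add: f_def)
  have f2: "f (p i) = 2 * e i" if "i \<in> I" for i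
    using that disj the_inv_into_f_f[OF p that] by (auto simp: f_def)
  have f3: "f x = h x" if "x \<in> ?R" for x using that by (auto simp: f_def)
  have eI: "e ` I = {1..?k}" using e by (rule bij_betw_imp_surj_on)
  have hR: "h ` ?R = {2 * ?k<..n}" using h by (rule bij_betw_imp_surj_on)
  have "{1..n} \<subseteq> f ` {1..n}"
  proof
    fix y assume y: "y \<in> {1..n}"
    consider "y > 2 * ?k" | i where "i \<in> {1..?k}" "y = 2 * i - 1" | i where "i \<in> {1..?k}" "y = 2 * i"
    proof (cases "y > 2 * ?k")
      case False
      show thesis
      proof (cases "even y")
        case True
        then obtain i where "y = 2 * i" by blast
        with that(3)[of i] y False show thesis by auto
      next
        case odd: False
        then obtain i where "y = 2 * i + 1" using oddE by blast
        with that(2)[of "i + 1"] y False show thesis by auto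
      qed
    qed
    then show "y \<in> f ` {1..n}"
    proof cases
      case 1
      then have "y \<in> h ` ?R" using hR y by auto
      then show ?thesis using f3 by force
    next
      case 2
      then obtain x where "x \<in> I" "e x = i" using eI by (metis imageE)
      then show ?thesis using f1 2 I(1) by force
    next
      case 3
      then obtain x where x: "x \<in> I" "e x = i" using eI by (metis imageE)
      then have "p x \<in> {1..n}" "f (p x) = y" using f2 3 I(2) by auto
      then show ?thesis by blast
    qed
  qed
  moreover have "f ` {1..n} \<subseteq> {1..n}"
  proof
    fix y assume "y \<in> f ` {1..n}"
    then obtain x where x: "x \<in> {1..n}" "y = f x" by blast
    have ei: "1 \<le> e i \<and> e i \<le> ?k" if "i \<in> I" for i using eI that by auto
    consider "x \<in> I" | i where "i \<in> I" "x = p i" | "x \<in> ?R" using x(1) by blast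
    then show "y \<in> {1..n}"
    proof cases
      case 1
      then show ?thesis using f1 ei[of x] le x(2) by auto
    next
      case 2
      then show ?thesis using f2 ei[of i] le x(2) by auto
    next
      case 3
      then have "h x \<in> {2 * ?k<..n}" using hR by blast
      then show ?thesis using f3[OF 3] x(2) by auto
    qed
  qed
  ultimately have "f ` {1..n} = {1..n}" by blast
  then have "bij_betw f {1..n} {1..n}"
    by (simp add: bij_betw_def eq_card_imp_inj_on)
  from that[OF this e f1 f2 le] show thesis by blast
qed

theorem theorem1p2:
  fixes n :: nat and \<A> \<B> :: "nat set set"
  assumes "half_cross_intersecting n \<A> \<B>"
    and "card \<A> * card \<B> = 2 ^ n"
  shows "\<exists>f. bij_betw f {1..n} {1..n} \<and>
           (\<exists>k\<in>{0..n div 2}. (relabel f \<A>, relabel f \<B>) = (\<A>_fam n k, \<B>_fam n k))"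
proof -
  have sub: "\<A> \<subseteq> Pow {1..n}" "\<B> \<subseteq> Pow {1..n}"
    and "\<forall>A\<in>\<A>. \<forall>B\<in>\<B>. real (card (A \<inter> B)) = 1/2 * real (card B)"
    using assms(1) by (auto simp: half_cross_intersecting_def)
  then have half: "2 * card (A \<inter> B) = card B" if "A \<in> \<A>" "B \<in> \<B>" for A B
    using that by fastforce
  obtain I p where I: "I \<subseteq> {1..n}" and pI: "p ` I \<subseteq> {1..n} - I" and injp: "inj_on p I"
    and A: "\<A> = {A \<in> Pow {1..n}. \<forall>i\<in>I. i \<in> A \<longleftrightarrow> p i \<notin> A}"
    and B: "\<B> = {B \<in> Pow (I \<union> p ` I). \<forall>i\<in>I. i \<in> B \<longleftrightarrow> p i \<in> B}"
  proof (rule extremal_half_cross_structure[OF _ sub half])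
    show "card \<A> * card \<B> = 2 ^ card {1..n}" using assms(2) by simp
  qed simp_all
  obtain f e where f: "bij_betw f {1..n} {1..n}" and e: "bij_betw e I {1..card I}"
    and f1: "\<And>i. i \<in> I \<Longrightarrow> f i = 2 * e i - 1" and f2: "\<And>i. i \<in> I \<Longrightarrow> f (p i) = 2 * e i"
    and k: "2 * card I \<le> n"
    using pairs_standard_labelling[OF I pI injp] by blast
  let ?k = "card I"
  have injf: "inj_on f {1..n}" and fX: "f ` {1..n} = {1..n}"
    using f by (auto simp: bij_betw_def)
  have mem: "f x \<in> f ` C \<longleftrightarrow> x \<in> C" if "C \<subseteq> {1..n}" "x \<in> {1..n}" for C x
    using inj_on_image_mem_iff[OF injf that(2,1)] .
  \<comment> \<open>One transfer principle for both families: \<open>P\<close> is inequivalence for \<open>\<A>\<close>, equivalence for \<open>\<B>\<close>.\<close>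
  have pairs: "(\<forall>i\<in>{1..?k}. P (2 * i - 1 \<in> f ` C) (2 * i \<in> f ` C)) \<longleftrightarrow> (\<forall>i\<in>I. P (i \<in> C) (p i \<in> C))"
    if C: "C \<subseteq> {1..n}" for C P
  proof -
    have "(\<forall>i\<in>{1..?k}. P (2 * i - 1 \<in> f ` C) (2 * i \<in> f ` C)) \<longleftrightarrow>
          (\<forall>i\<in>I. P (f i \<in> f ` C) (f (p i) \<in> f ` C))"
      unfolding bij_betw_imp_surj_on[OF e, symmetric] by (simp add: f1 f2)
    also have "\<dots> \<longleftrightarrow> (\<forall>i\<in>I. P (i \<in> C) (p i \<in> C))"
    proof (rule ball_cong[OF refl])
      fix i assume "i \<in> I"
      then have "i \<in> {1..n}" "p i \<in> {1..n}" using I pI by auto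
      then show "P (f i \<in> f ` C) (f (p i) \<in> f ` C) \<longleftrightarrow> P (i \<in> C) (p i \<in> C)"
        by (simp add: mem[OF C])
    qed
    finally show ?thesis .
  qed
  have U: "I \<union> p ` I \<subseteq> {1..n}" using I pI by auto
  have fU: "f ` (I \<union> p ` I) = {1..2 * ?k}"
  proof (rule card_subset_eq)
    have "f i \<in> {1..2 * ?k} \<and> f (p i) \<in> {1..2 * ?k}" if "i \<in> I" for i
      using bij_betwE[OF e] that by (auto simp: f1 f2)
    then show "f ` (I \<union> p ` I) \<subseteq> {1..2 * ?k}" by blast
    have "card (I \<union> p ` I) = 2 * ?k"
      using pI finite_subset[OF I] by (subst card_Un_disjoint) (auto simp: card_image[OF injp])
    then show "card (f ` (I \<union> p ` I)) = card {1..2 * ?k}"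
      using card_image[OF inj_on_subset[OF injf U]] by simp
  qed simp
  have rA: "relabel f \<A> = \<A>_fam n ?k"
  proof (rule relabel_eqI[OF f sub(1)])
    show "\<A>_fam n ?k \<subseteq> Pow {1..n}" by (rule subsetI) (simp add: \<A>_fam_iff)
    fix C assume C: "C \<subseteq> {1..n}"
    then have "f ` C \<subseteq> {1..n}" using fX by blast
    then show "f ` C \<in> \<A>_fam n ?k \<longleftrightarrow> C \<in> \<A>"
      using C pairs[OF C, of "\<lambda>a b. a \<longleftrightarrow> \<not> b"] by (simp add: \<A>_fam_iff A)
  qed
  have rB: "relabel f \<B> = \<B>_fam n ?k"
  proof (rule relabel_eqI[OF f sub(2)])
    have "{1..2 * ?k} \<subseteq> {1..n}" using k by simp
    moreover have "B' \<subseteq> {1..2 * ?k}" if "B' \<in> \<B>_fam n ?k" for B'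
      using that by (simp add: \<B>_fam_iff[OF k])
    ultimately show "\<B>_fam n ?k \<subseteq> Pow {1..n}" by blast
    fix C assume C: "C \<subseteq> {1..n}"
    have "f ` C \<subseteq> {1..2 * ?k} \<longleftrightarrow> C \<subseteq> I \<union> p ` I"
    proof -
      have "(\<forall>x\<in>C. f x \<in> f ` (I \<union> p ` I)) \<longleftrightarrow> (\<forall>x\<in>C. x \<in> I \<union> p ` I)"
        using C by (intro ball_cong refl mem[OF U]) blast
      then show ?thesis unfolding fU[symmetric] by (simp only: subset_eq ball_simps)
    qed
    then show "f ` C \<in> \<B>_fam n ?k \<longleftrightarrow> C \<in> \<B>"
      using pairs[OF C, of "\<lambda>a b. a \<longleftrightarrow> b"] by (simp add: \<B>_fam_iff[OF k] B)
  qed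
  have "?k \<in> {0..n div 2}" using k by simp
  with f rA rB show ?thesis by blast
qed

end
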